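(* Let $\Theta$ be a continuous ellipsoid cover of $\mathbb{R}^n$ and let $K$ be the kernel of a variable anisotropic singular integral operator (VASIO) of order $1$ with respect to $\Theta$. Then there exist positive constants $\delta$ and $C$ such that for all $x\ne y\in\mathbb{R}^n$ we have $$|K(x,y)|\le C/\rho_\Theta(x,y),$$ $$|K(x,y)-K(x,y')|\le C\frac{[\rho_\Theta(y,y')]^\delta}{[\rho_\Theta(x,y)]^{1+\delta}}\qquad\text{if }\ \rho_\Theta(y,y')\le\frac1{2\kappa}\rho_\Theta(x,y).$$ In particular, there exist two positive constants $c>1$ and $C$ such that $$\int_{\mathbb{R}^n\setminus B_{\rho_\Theta}(y,cr)}|K(x,y)-K(x,y')|\,dx\le C\qquad\text{for all }y\in\mathbb{R}^n,\ r>0,\ y'\in B_{\rho_\Theta}(y,r).$$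
   Context: **Ellipsoid covers.** Let $\mathbb{B}^n=\{x\in\mathbb{R}^n:|x|<1\}$ and $\|M\|=\max_{|x|=1}|Mx|$ for a matrix $M$. A continuous ellipsoid cover of $\mathbb{R}^n$ is a family $\Theta=\{\theta_{x,t}:x\in\mathbb{R}^n,t\in\mathbb{R}\}$ of ellipsoids $\theta_{x,t}=M_{x,t}(\mathbb{B}^n)+x$, with $M_{x,t}$ an invertible $n\times n$ real matrix, for which there are positive constants $\mathbf{p}(\Theta)=\{a_1,\ldots,a_6\}$ such that (i) $a_12^{-t}\le|\theta_{x,t}|\le a_22^{-t}$ for all $x\in\mathbb{R}^n,t\in\mathbb{R}$; (ii) for all $x,y\in\mathbb{R}^n$, $t\in\mathbb{R}$, $s\ge0$ with $\theta_{x,t}\cap\theta_{y,t+s}\neq\emptyset$, $$a_32^{-a_4s}\le 1/\|(M_{y,t+s})^{-1}M_{x,t}\|\le\|(M_{x,t})^{-1}M_{y,t+s}\|\le a_52^{-a_6s}.$$ **Quasi-distance.** $\rho_\Theta(x,y)=\inf\{|\theta|:\theta\in\Theta,\ x,y\in\theta\}$. It is a quasi-distance on $\mathbb{R}^n$: symmetric, zero exactly when $x=y$, and $\rho_\Theta(x,y)\le\kappa(\rho_\Theta(x,z)+\rho_\Theta(y,z))$ for a constant $\kappa\ge1$, which is the constant $\kappa$ in the statement. $B_{\rho_\Theta}(x,r)=\{y:\rho_\Theta(x,y)<r\}$. **VASIO.** Let $\Omega=\{(x,y)\in\mathbb{R}^n\times\mathbb{R}^n:x\ne y\}$. A locally square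 integrable function $K$ on $\Omega$ is a variable anisotropic singular integral kernel with respect to $\Theta$ if there are constants $c>1$ and $C>0$ such that for all $y\in\mathbb{R}^n$, $r>0$, $y'\in B_{\rho_\Theta}(y,r)$, $\int_{\mathbb{R}^n\setminus B_{\rho_\Theta}(y,cr)}|K(x,y)-K(x,y')|\,dx\le C$. A bounded linear operator $T:L^2\to L^2$ is a VASIO (of order $0$) if there is such a kernel $K$ with $Tf(x)=\int_{\mathbb{R}^n}K(x,y)f(y)\,dy$ for all $f\in C_c^\infty$ and $x\notin\operatorname{supp}f$. For $s\in\mathbb{N}_0$, $T$ is a VASIO of order $s$ if moreover $K(x,y)$ is of class $C^s$ in $y$ and there is $C>0$ such that for all $(x,y)\in\Omega$ and multi-indices $|\alpha|\le s$, $$\left|\partial_y^\alpha[K(\cdot,M_{y,m}\cdot)](x,M_{y,m}^{-1}y)\right|\le C/\rho_\Theta(x,y),\qquad m:=-\log_2\rho_\Theta(x,y).$$ Here the left side means $|\partial^\alpha_v\widetilde K(x,v)|$ evaluated at $v=M_{y,m}^{-1}y$, where $\widetilde K(u,v)=K(u,M_{y,m}v)$ and the matrix $M_{y,m}$ is kept fixed in the differentiation. (The last integral estimate in the claim is stated as a consequence of the two pointwise estimates.) *)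

theory Defs
  imports "HOL-Analysis.Analysis"
begin

section \<open>Ellipsoid covers and the induced quasi-distance\<close>

text \<open>A cover is represented by its matrices \<open>M x t\<close>.\<close>

definition ellipsoid :: "(real^'n \<Rightarrow> real \<Rightarrow> real^'n^'n) \<Rightarrow> real^'n \<Rightarrow> real \<Rightarrow> (real^'n) set" where
  "ellipsoid M x t = (\<lambda>u. M x t *v u + x) ` ball 0 1"

definition opnorm :: "real^'n^'n \<Rightarrow> real" where
  "opnorm A = onorm ((*v) A)"

definition ellipsoid_cover :: "(real^'n \<Rightarrow> real \<Rightarrow> real^'n^'n) \<Rightarrow> bool" where
  "ellipsoid_cover M \<longleftrightarrow>
     (\<forall>x t. invertible (M x t)) \<and>
     (\<exists>a1>0. \<exists>a2>0. \<exists>a3>0. \<exists>a4>0. \<exists>a5>0. \<exists>a6>0.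
        (\<forall>x t. a1 * 2 powr (- t) \<le> measure lebesgue (ellipsoid M x t) \<and>
               measure lebesgue (ellipsoid M x t) \<le> a2 * 2 powr (- t)) \<and>
        (\<forall>x y t. \<forall>s\<ge>0. ellipsoid M x t \<inter> ellipsoid M y (t + s) \<noteq> {} \<longrightarrow>
           a3 * 2 powr (- a4 * s) \<le> 1 / opnorm (matrix_inv (M y (t + s)) ** M x t) \<and>
           1 / opnorm (matrix_inv (M y (t + s)) ** M x t)
             \<le> opnorm (matrix_inv (M x t) ** M y (t + s)) \<and>
           opnorm (matrix_inv (M x t) ** M y (t + s)) \<le> a5 * 2 powr (- a6 * s)))"

definition rho :: "(real^'n \<Rightarrow> real \<Rightarrow> real^'n^'n) \<Rightarrow> real^'n \<Rightarrow> real^'n \<Rightarrow> real" where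
  "rho M x y = Inf {measure lebesgue (ellipsoid M z t) | z t.
                      x \<in> ellipsoid M z t \<and> y \<in> ellipsoid M z t}"

definition rho_ball :: "(real^'n \<Rightarrow> real \<Rightarrow> real^'n^'n) \<Rightarrow> real^'n \<Rightarrow> real \<Rightarrow> (real^'n) set" where
  "rho_ball M x r = {y. rho M x y < r}"

definition quasi_triangle_constant :: "(real^'n \<Rightarrow> real \<Rightarrow> real^'n^'n) \<Rightarrow> real \<Rightarrow> bool" where
  "quasi_triangle_constant M \<kappa> \<longleftrightarrow>
     \<kappa> \<ge> 1 \<and> (\<forall>x y z. rho M x y \<le> \<kappa> * (rho M x z + rho M y z))"


section \<open>Partial derivatives and functions of class \<open>C\<^sup>s\<close>\<close>

definition partial_deriv :: "'n \<Rightarrow> (real^'n \<Rightarrow> complex) \<Rightarrow> real^'n \<Rightarrow> complex" where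
  "partial_deriv i f v = vector_derivative (\<lambda>t. f (v + t *\<^sub>R axis i 1)) (at 0)"

text \<open>A multi-index \<open>\<alpha>\<close> is given by a list of coordinate indices in which \<open>i\<close> occurs
  \<open>\<alpha>\<^sub>i\<close> times, so \<open>|\<alpha>|\<close> is the length of the list. For functions of class \<open>C\<^sup>s\<close> and
  \<open>|\<alpha>| \<le> s\<close> the order of the entries is immaterial.\<close>

primrec iter_partial :: "'n list \<Rightarrow> (real^'n \<Rightarrow> complex) \<Rightarrow> real^'n \<Rightarrow> complex" where
  "iter_partial [] f = f"
| "iter_partial (i # \<alpha>) f = partial_deriv i (iter_partial \<alpha> f)"

text \<open>The existence of the partial derivatives is demanded separately because
  \<^const>\<open>vector_derivative\<close> is a total function. The set \<open>U\<close> is meant to be open.\<close>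

definition class_C :: "nat \<Rightarrow> (real^'n) set \<Rightarrow> (real^'n \<Rightarrow> complex) \<Rightarrow> bool" where
  "class_C s U f \<longleftrightarrow>
     (\<forall>\<alpha>. length \<alpha> < s \<longrightarrow>
        (\<forall>i. \<forall>v\<in>U. (\<lambda>t. iter_partial \<alpha> f (v + t *\<^sub>R axis i 1)) differentiable (at (0::real)))) \<and>
     (\<forall>\<alpha>. length \<alpha> \<le> s \<longrightarrow> continuous_on U (iter_partial \<alpha> f))"

definition supp :: "(real^'n \<Rightarrow> complex) \<Rightarrow> (real^'n) set" where
  "supp f = closure {x. f x \<noteq> 0}"

definition test_function :: "(real^'n \<Rightarrow> complex) \<Rightarrow> bool" where
  "test_function f \<longleftrightarrow> compact (supp f) \<and> (\<forall>s. class_C s UNIV f)"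


section \<open>Bounded operators on \<open>L\<^sup>2\<close>\<close>

text \<open>Elements of \<open>L\<^sup>2\<close> are handled through representatives. That \<open>T\<close> respects equality
  almost everywhere follows from linearity and boundedness.\<close>

definition in_L2 :: "(real^'n \<Rightarrow> complex) \<Rightarrow> bool" where
  "in_L2 f \<longleftrightarrow> f \<in> borel_measurable lebesgue \<and> integrable lebesgue (\<lambda>x. (norm (f x))\<^sup>2)"

definition L2_norm :: "(real^'n \<Rightarrow> complex) \<Rightarrow> real" where
  "L2_norm f = sqrt (\<integral>x. (norm (f x))\<^sup>2 \<partial>lebesgue)"

definition bounded_linear_L2 :: "((real^'n \<Rightarrow> complex) \<Rightarrow> real^'n \<Rightarrow> complex) \<Rightarrow> bool" where
  "bounded_linear_L2 T \<longleftrightarrow>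
     (\<forall>f. in_L2 f \<longrightarrow> in_L2 (T f)) \<and>
     (\<forall>f g. in_L2 f \<and> in_L2 g \<longrightarrow>
        (AE x in lebesgue. T (\<lambda>u. f u + g u) x = T f x + T g x)) \<and>
     (\<forall>a f. in_L2 f \<longrightarrow> (AE x in lebesgue. T (\<lambda>u. a * f u) x = a * T f x)) \<and>
     (\<exists>A. \<forall>f. in_L2 f \<longrightarrow> L2_norm (T f) \<le> A * L2_norm f)"


section \<open>Variable anisotropic singular integral operators\<close>

text \<open>Kernels are total functions whose values on the diagonal are irrelevant.\<close>

definition off_diagonal :: "((real^'n) \<times> (real^'n)) set" where
  "off_diagonal = {(x, y). x \<noteq> y}"

definition locally_square_integrable :: "(real^'n \<Rightarrow> real^'n \<Rightarrow> complex) \<Rightarrow> bool" where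
  "locally_square_integrable K \<longleftrightarrow>
     set_borel_measurable lebesgue off_diagonal (\<lambda>(x, y). K x y) \<and>
     (\<forall>S. compact S \<and> S \<subseteq> off_diagonal \<longrightarrow>
        set_integrable lebesgue S (\<lambda>(x, y). (norm (K x y))\<^sup>2))"

text \<open>The integrand is nonnegative, so the integral is taken with values in \<open>[0,\<infinity>]\<close>.
  If \<open>K\<close> is jointly measurable and continuous in its second variable off the diagonal (in
  particular for kernels of order at least 1), then \<open>x \<mapsto> K x y\<close> is measurable for every
  \<open>y\<close>, and not only for almost every \<open>y\<close>.\<close>

definition integral_estimate ::
  "(real^'n \<Rightarrow> real \<Rightarrow> real^'n^'n) \<Rightarrow> (real^'n \<Rightarrow> real^'n \<Rightarrow> complex) \<Rightarrow> real \<Rightarrow> real \<Rightarrow> bool" where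
  "integral_estimate M K c C \<longleftrightarrow>
     (\<forall>y. \<forall>r>0. \<forall>y'\<in>rho_ball M y r.
        (\<integral>\<^sup>+x\<in>UNIV - rho_ball M y (c * r). ennreal (norm (K x y - K x y')) \<partial>lebesgue) \<le> ennreal C)"

definition vasio_kernel ::
  "(real^'n \<Rightarrow> real \<Rightarrow> real^'n^'n) \<Rightarrow> (real^'n \<Rightarrow> real^'n \<Rightarrow> complex) \<Rightarrow> bool" where
  "vasio_kernel M K \<longleftrightarrow>
     locally_square_integrable K \<and> (\<exists>c>1. \<exists>C>0. integral_estimate M K c C)"

text \<open>Since \<open>T f\<close> is an element of \<open>L\<^sup>2\<close>, the integral representation off the support is
  an identity almost everywhere.\<close>

definition vasio ::
  "(real^'n \<Rightarrow> real \<Rightarrow> real^'n^'n) \<Rightarrow> ((real^'n \<Rightarrow> complex) \<Rightarrow> real^'n \<Rightarrow> complex)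
     \<Rightarrow> (real^'n \<Rightarrow> real^'n \<Rightarrow> complex) \<Rightarrow> bool" where
  "vasio M T K \<longleftrightarrow>
     bounded_linear_L2 T \<and> vasio_kernel M K \<and>
     (\<forall>f. test_function f \<longrightarrow>
        (AE x in lebesgue. x \<notin> supp f \<longrightarrow> T f x = (\<integral>y. K x y * f y \<partial>lebesgue)))"

definition vasio_of_order ::
  "nat \<Rightarrow> (real^'n \<Rightarrow> real \<Rightarrow> real^'n^'n) \<Rightarrow> ((real^'n \<Rightarrow> complex) \<Rightarrow> real^'n \<Rightarrow> complex)
     \<Rightarrow> (real^'n \<Rightarrow> real^'n \<Rightarrow> complex) \<Rightarrow> bool" where
  "vasio_of_order s M T K \<longleftrightarrow>
     vasio M T K \<and>
     (\<forall>x. class_C s (UNIV - {x}) (K x)) \<and>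
     (\<exists>C>0. \<forall>x y \<alpha>. x \<noteq> y \<and> length \<alpha> \<le> s \<longrightarrow>
        (let A = M y (- log 2 (rho M x y))
         in norm (iter_partial \<alpha> (\<lambda>v. K x (A *v v)) (matrix_inv A *v y)) \<le> C / rho M x y))"

definition pointwise_estimates ::
  "(real^'n \<Rightarrow> real \<Rightarrow> real^'n^'n) \<Rightarrow> real \<Rightarrow> (real^'n \<Rightarrow> real^'n \<Rightarrow> complex)
     \<Rightarrow> real \<Rightarrow> real \<Rightarrow> bool" where
  "pointwise_estimates M \<kappa> K \<delta> C \<longleftrightarrow>
     (\<forall>x y. x \<noteq> y \<longrightarrow>
        norm (K x y) \<le> C / rho M x y \<and>
        (\<forall>y'. rho M y y' \<le> 1 / (2 * \<kappa>) * rho M x y \<longrightarrow>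
           norm (K x y - K x y') \<le> C * (rho M y y' powr \<delta> / rho M x y powr (1 + \<delta>))))"

end

theory Submission
  imports Defs
begin

text \<open>The idea is to read both pointwise estimates at the scale of the kernel. Put
  \<open>r = \<rho>(x,\<xi>)\<close>. In the coordinates \<open>v = A\<^sup>-\<^sup>1 \<xi>\<close> given by the matrix \<open>A\<close> of the ellipsoid
  centred at \<open>\<xi>\<close> whose volume is comparable to \<open>r\<close>, the kernel \<open>K(x,\<cdot>)\<close> and its first partial
  derivatives are bounded by \<open>C/r\<close> at \<open>\<xi>\<close>. The bound on the size is the first estimate. For the second, take an
  ellipsoid \<open>\<theta>\<close> that contains \<open>y\<close> and \<open>y'\<close> and whose volume is less than \<open>3/2 \<rho>(y,y')\<close>.
  It is convex, so it contains the segment from \<open>y'\<close> to \<open>y\<close>; and it is so small that, by the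
  quasi-triangle inequality, every point \<open>\<xi>\<close> of it satisfies \<open>\<rho>(x,\<xi>) \<ge> \<rho>(x,y) / (4\<kappa>)\<close>. By the
  shape condition of the cover, \<open>\<theta>\<close> has, in the coordinates adapted to \<open>\<xi>\<close>, a diameter of at most a
  multiple of \<open>(\<rho>(y,y') / \<rho>(x,y))\<close> to the power \<open>a\<^sub>6\<close>
  (\<open>norm_inv_diff_le_if_small_volume\<close>). Integrating the
  gradient along the segment gives the estimate with \<open>\<delta> = a\<^sub>6\<close>
  (\<open>norm_diff_le_on_ellipsoid\<close>). This needs \<open>\<theta>\<close> to be smaller than the
  adapted ellipsoids; if it is not, then \<open>\<rho>(y,y')\<close> and \<open>\<rho>(x,y)\<close> are comparable and the size bound at \<open>y\<close>
  and at \<open>y'\<close> suffices (\<open>pointwise_estimates_if_adapted_gradient_bound\<close>).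

  The integral estimate follows by decomposing the complement of a ball into dyadic annuli: a
  \<open>\<rho>\<close>-ball of radius \<open>R\<close> has volume at most a multiple of \<open>R\<close> (\<open>emeasure_rho_ball_le\<close>), so the annulus
  between the radii \<open>2\<^sup>k R\<close> and \<open>2\<^sup>k\<^sup>+\<^sup>1 R\<close> contributes at most a multiple of \<open>2\<close> to the power \<open>-k\<delta>\<close>,
  and these numbers are
  summable.\<close>

section \<open>Differentiability and adapted partial derivatives\<close>

lemma norm_diff_le_if_norm_vector_derivative_le:
  fixes g :: "real \<Rightarrow> 'a::real_normed_vector"
  assumes "convex S" and g: "\<And>t. t \<in> S \<Longrightarrow> (g has_vector_derivative g' t) (at t within S)"
    and B: "\<And>t. t \<in> S \<Longrightarrow> norm (g' t) \<le> B" and "s \<in> S" "t \<in> S"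
  shows "norm (g s - g t) \<le> B * \<bar>s - t\<bar>"
proof -
  have "onorm (\<lambda>u. u *\<^sub>R g' t) \<le> B" if "t \<in> S" for t
    using onorm_scaleR_left[OF bounded_linear_ident, of "g' t"] B[OF that] by (simp add: onorm_id)
  then show ?thesis
    using differentiable_bound[of S g "\<lambda>t u. u *\<^sub>R g' t" B s t] assms
    by (simp add: has_vector_derivative_def)
qed

text \<open>The increment is built up one coordinate at a time. In the step for coordinate \<open>i\<close> only the
  \<open>i\<close>-th partial derivative enters, taken at points near \<open>v\<close>, where by continuity it differs
  little from its value at \<open>v\<close>.\<close>

lemma has_derivative_if_class_C_1:
  fixes f :: "real^'n \<Rightarrow> complex"
  assumes f: "class_C 1 U f" and U: "open U" "v \<in> U"
  shows "(f has_derivative (\<lambda>h. \<Sum>i\<in>UNIV. h $ i *\<^sub>R partial_deriv i f v)) (at v)"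
  unfolding has_derivative_at_alt
proof (intro conjI allI impI)
  show "bounded_linear (\<lambda>h. \<Sum>i\<in>UNIV. h $ i *\<^sub>R partial_deriv i f v)"
    by (intro bounded_linear_sum bounded_linear_scaleR_left[THEN bounded_linear_compose]
        bounded_linear_vec_nth)
  fix e :: real assume "e > 0"
  \<comment> \<open>There are \<open>n\<close> coordinate steps: the error \<open>e\<close> is shared among them, and the intermediate points
     move away from \<open>v\<close> by at most \<open>n\<close> times the norm of the increment.\<close>
  define n where "n = real CARD('n)"
  have n: "n > 0" by (simp add: n_def)
  define e' where "e' = e / n"
  have e': "e' > 0" using \<open>e > 0\<close> n by (simp add: e'_def)
  have "continuous_on U (partial_deriv i f)" for i
    using f[unfolded class_C_def, THEN conjunct2, rule_format, of "[i]"] by simp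
  then have "isCont (partial_deriv i f) v" for i
    using U continuous_on_eq_continuous_at by blast
  then have "\<forall>i. \<exists>d>0. \<forall>w. dist w v < d \<longrightarrow> dist (partial_deriv i f w) (partial_deriv i f v) < e'"
    using e' unfolding continuous_at_eps_delta by blast
  then obtain d where d: "\<And>i. d i > 0"
    "\<And>i w. dist w v < d i \<Longrightarrow> dist (partial_deriv i f w) (partial_deriv i f v) < e'"
    by metis
  obtain d0 where d0: "d0 > 0" "ball v d0 \<subseteq> U"
    using U open_contains_ball by blast
  define \<delta> where "\<delta> = Min (insert d0 (range d)) / n"
  have \<delta>: "\<delta> > 0" using d0 d n by (auto simp: \<delta>_def)
  have \<delta>_le: "n * \<delta> \<le> d0" "n * \<delta> \<le> d i" for i
    using n by (auto simp: \<delta>_def intro!: min.coboundedI2)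
  have main: "norm (f w - f v - (\<Sum>i\<in>UNIV. (w - v) $ i *\<^sub>R partial_deriv i f v)) \<le> e * norm (w - v)"
    if w: "norm (w - v) < \<delta>" for w
  proof -
    define h where "h = w - v"
    define r where "r S = (\<Sum>i\<in>S. h $ i *\<^sub>R (axis i 1 :: real^'n))" for S
    have near: "norm (r S + t *\<^sub>R axis i 1) < n * \<delta>"
      if "finite S" "i \<notin> S" "\<bar>t\<bar> \<le> \<bar>h $ i\<bar>" for S i t
    proof -
      have "norm (r S + t *\<^sub>R (axis i 1 :: real^'n)) \<le> (\<Sum>j\<in>S. \<bar>h $ j\<bar>) + \<bar>h $ i\<bar>"
        unfolding r_def
        by (rule norm_triangle_le[OF add_mono]) (use that in \<open>auto intro!: sum_norm_le\<close>)
      also have "\<dots> = (\<Sum>j\<in>insert i S. \<bar>h $ j\<bar>)" using that by simp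
      also have "\<dots> \<le> (\<Sum>j\<in>UNIV. \<bar>h $ j\<bar>)" by (rule sum_mono2) auto
      also have "\<dots> \<le> (\<Sum>j\<in>(UNIV::'n set). norm h)" by (intro sum_mono component_le_norm_cart)
      also have "\<dots> = n * norm h" by (simp add: n_def)
      also have "\<dots> < n * \<delta>" using w n by (simp add: h_def)
      finally show ?thesis .
    qed
    have "norm (f (v + r S) - f v - (\<Sum>i\<in>S. h $ i *\<^sub>R partial_deriv i f v)) \<le> (\<Sum>i\<in>S. e' * norm h)"
      if "finite S" for S
      using that
    proof (induction S)
      case empty
      then show ?case by (simp add: r_def)
    next
      case (insert i S)
      define p where "p = v + r S"
      have rI: "v + r (insert i S) = p + (h $ i) *\<^sub>R axis i 1"
        using insert.hyps by (simp add: r_def p_def)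
      \<comment> \<open>Subtracting the linear part leaves a function whose derivative is small.\<close>
      define g where "g = (\<lambda>t. f (p + t *\<^sub>R axis i 1) - t *\<^sub>R partial_deriv i f v)"
      define g' where "g' = (\<lambda>t. partial_deriv i f (p + t *\<^sub>R axis i 1) - partial_deriv i f v)"
      have in_ball: "dist (p + t *\<^sub>R axis i 1) v < n * \<delta>" if "\<bar>t\<bar> \<le> \<bar>h $ i\<bar>" for t
        using near[OF insert.hyps that] by (simp add: p_def dist_norm algebra_simps)
      have deriv: "(g has_vector_derivative g' t) (at t)" if "\<bar>t\<bar> \<le> \<bar>h $ i\<bar>" for t
      proof -
        let ?q = "p + t *\<^sub>R axis i 1"
        have "?q \<in> U" using in_ball[OF that] \<delta>_le(1) d0 by (auto simp: dist_commute)
        then have "(\<lambda>u. f (?q + u *\<^sub>R axis i 1)) differentiable at (0::real)"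
          using f[unfolded class_C_def, THEN conjunct1, rule_format, of "[]"] by simp
        then have "((\<lambda>u. f (?q + u *\<^sub>R axis i 1)) has_vector_derivative partial_deriv i f ?q) (at 0)"
          unfolding partial_deriv_def by (simp add: vector_derivative_works)
        then have "(((\<lambda>u. f (?q + u *\<^sub>R axis i 1)) \<circ> (\<lambda>u. u - t)) has_vector_derivative
             (1 *\<^sub>R partial_deriv i f ?q)) (at t)"
          by (intro vector_diff_chain_at) (auto intro!: derivative_eq_intros)
        then have "((\<lambda>u. f (p + u *\<^sub>R axis i 1)) has_vector_derivative partial_deriv i f ?q) (at t)"
          by (simp add: o_def algebra_simps)
        then show ?thesis unfolding g_def g'_def by (auto intro!: derivative_eq_intros)
      qed
      have "norm (g (h $ i) - g 0) \<le> e' * \<bar>h $ i - 0\<bar>"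
      proof (rule norm_diff_le_if_norm_vector_derivative_le)
        show "convex (closed_segment 0 (h $ i))" by simp
        fix t assume t: "t \<in> closed_segment 0 (h $ i)"
        then have t': "\<bar>t\<bar> \<le> \<bar>h $ i\<bar>" by (auto simp: closed_segment_eq_real_ivl split: if_splits)
        show "(g has_vector_derivative g' t) (at t within closed_segment 0 (h $ i))"
          using deriv[OF t'] by (rule has_vector_derivative_at_within)
        show "norm (g' t) \<le> e'"
          using d(2)[of "p + t *\<^sub>R axis i 1" i] in_ball[OF t'] \<delta>_le(2)[of i]
          by (simp add: g'_def dist_norm)
      qed auto
      also have "\<dots> \<le> e' * norm h"
        using e' component_le_norm_cart[of h i] by (intro mult_left_mono) auto
      finally have step: "norm (g (h $ i) - g 0) \<le> e' * norm h" .
      have "f (v + r (insert i S)) - f v - (\<Sum>i\<in>insert i S. h $ i *\<^sub>R partial_deriv i f v)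
          = (g (h $ i) - g 0) + (f (v + r S) - f v - (\<Sum>i\<in>S. h $ i *\<^sub>R partial_deriv i f v))"
        using insert.hyps by (simp add: rI g_def p_def)
      then show ?case
        using norm_triangle_le[OF add_mono[OF step insert.IH]]
        by (simp only: sum.insert[OF insert.hyps])
    qed
    from this[of UNIV] have "norm (f (v + r UNIV) - f v - (\<Sum>i\<in>UNIV. h $ i *\<^sub>R partial_deriv i f v))
        \<le> n * (e' * norm h)" by (simp add: n_def)
    moreover have "v + r UNIV = w"
      unfolding r_def h_def by (simp add: basis_expansion[of "w - v", unfolded scalar_mult_eq_scaleR]
          del: vector_minus_component)
    moreover have "n * (e' * norm h) = e * norm (w - v)" using n by (simp add: e'_def h_def)
    ultimately show ?thesis by (simp only: h_def)
  qed
  show "\<exists>d>0. \<forall>y. norm (y - v) < d \<longrightarrow>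
      norm (f y - f v - (\<Sum>i\<in>UNIV. (y - v) $ i *\<^sub>R partial_deriv i f v)) \<le> e * norm (y - v)"
    using \<delta> main by blast
qed

lemma
  fixes A :: "real^'n^'n"
  assumes "invertible A"
  shows matrix_mul_matrix_inv: "A ** matrix_inv A = mat 1"
    and matrix_inv_matrix_mul: "matrix_inv A ** A = mat 1"
  using someI_ex[OF assms[unfolded invertible_def]] unfolding matrix_inv_def by auto

text \<open>The partial derivatives of \<open>f \<circ> A\<close> are the derivatives of \<open>f\<close> along the columns of \<open>A\<close>, and
  \<open>A\<^sup>-\<^sup>1 h\<close> lists the coefficients of \<open>h\<close> with respect to these columns.\<close>

lemma norm_derivative_le_adapted_partials:
  fixes f :: "real^'n \<Rightarrow> complex" and A :: "real^'n^'n"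
  assumes D: "(f has_derivative D) (at p)" and A: "invertible A"
    and B: "\<And>i. norm (partial_deriv i (\<lambda>v. f (A *v v)) (matrix_inv A *v p)) \<le> B"
  shows "norm (D h) \<le> real CARD('n) * norm (matrix_inv A *v h) * B"
proof -
  have AA: "A *v (matrix_inv A *v w) = w" for w
    using A by (simp add: matrix_vector_mul_assoc matrix_mul_matrix_inv)
  interpret D: bounded_linear D using D by (rule has_derivative_bounded_linear)
  define c where "c = matrix_inv A *v h"
  have col: "partial_deriv i (\<lambda>v. f (A *v v)) (matrix_inv A *v p) = D (A *v axis i 1)" for i
  proof -
    have "((\<lambda>t. p + t *\<^sub>R (A *v axis i 1)) has_derivative (\<lambda>t. t *\<^sub>R (A *v axis i 1))) (at 0)"
      by (auto intro!: derivative_eq_intros)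
    from has_derivative_compose[OF this, of f D] D
    have "((\<lambda>t. f (p + t *\<^sub>R (A *v axis i 1))) has_derivative (\<lambda>t. t *\<^sub>R D (A *v axis i 1))) (at 0)"
      by (simp add: D.scaleR)
    then have "((\<lambda>t. f (A *v (matrix_inv A *v p + t *\<^sub>R axis i 1)))
        has_vector_derivative D (A *v axis i 1)) (at 0)"
      by (simp add: has_vector_derivative_def matrix_vector_right_distrib AA matrix_vector_mult_scaleR)
    then show ?thesis unfolding partial_deriv_def by (rule vector_derivative_at)
  qed
  have "h = A *v (\<Sum>i\<in>UNIV. c $ i *\<^sub>R axis i 1)"
    using basis_expansion[of c] by (simp add: c_def AA scalar_mult_eq_scaleR)
  also have "\<dots> = (\<Sum>i\<in>UNIV. c $ i *\<^sub>R (A *v axis i 1))"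
    by (simp add: matrix_vector_mult_scaleR linear_sum[OF matrix_vector_mul_linear] o_def)
  finally have "D h = (\<Sum>i\<in>UNIV. c $ i *\<^sub>R D (A *v axis i 1))"
    by (simp only: D.sum D.scaleR)
  also have "norm \<dots> \<le> (\<Sum>i\<in>(UNIV::'n set). norm c * B)"
    unfolding col[symmetric] using B
    by (intro sum_norm_le) (auto intro!: mult_mono component_le_norm_cart)
  finally show ?thesis by (simp add: c_def)
qed


section \<open>Geometry of ellipsoids\<close>

lemma mem_ellipsoid_iff:
  assumes "invertible (M x t)"
  shows "w \<in> ellipsoid M x t \<longleftrightarrow> norm (matrix_inv (M x t) *v (w - x)) < 1"
proof
  assume "w \<in> ellipsoid M x t"
  then show "norm (matrix_inv (M x t) *v (w - x)) < 1"
    using assms by (auto simp: ellipsoid_def matrix_vector_mul_assoc matrix_inv_matrix_mul)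
next
  assume "norm (matrix_inv (M x t) *v (w - x)) < 1"
  moreover have "w = M x t *v (matrix_inv (M x t) *v (w - x)) + x"
    using assms by (simp add: matrix_vector_mul_assoc matrix_mul_matrix_inv)
  ultimately show "w \<in> ellipsoid M x t" unfolding ellipsoid_def by auto
qed

lemma convex_ellipsoid: "convex (ellipsoid M x t)"
proof -
  have "ellipsoid M x t = (+) x ` ((*v) (M x t) ` ball 0 1)"
    by (auto simp: ellipsoid_def image_image add.commute)
  then show ?thesis
    by (simp only: convex_translation convex_linear_image[OF matrix_vector_mul_linear] convex_ball)
qed

lemma bounded_ellipsoid: "bounded (ellipsoid M x t)"
proof -
  have "ellipsoid M x t = (+) x ` ((*v) (M x t) ` ball 0 1)"
    by (auto simp: ellipsoid_def image_image add.commute)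
  then show ?thesis
    by (simp only: bounded_translation bounded_ball
        bounded_linear_image[OF _ matrix_vector_mul_bounded_linear])
qed

lemma open_ellipsoid:
  assumes "invertible (M x t)"
  shows "open (ellipsoid M x t)"
proof -
  have "ellipsoid M x t = {w. norm (matrix_inv (M x t) *v (w - x)) < 1}"
    using mem_ellipsoid_iff[of M x t, OF assms] by blast
  moreover have "continuous_on UNIV (\<lambda>w. norm (matrix_inv (M x t) *v (w - x)))"
    by (intro continuous_intros bounded_linear.continuous_on[OF matrix_vector_mul_bounded_linear])
  ultimately show ?thesis by (simp add: open_Collect_less)
qed

lemma rho_sym: "rho M x y = rho M y x"
  by (simp add: rho_def conj_commute)

lemma rho_le_measure:
  assumes "x \<in> ellipsoid M z t" "y \<in> ellipsoid M z t"
  shows "rho M x y \<le> measure lebesgue (ellipsoid M z t)"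
  unfolding rho_def using assms by (intro cInf_lower) (auto intro!: bdd_belowI[of _ 0])

lemma ex_two_powr_less:
  assumes "e > 0" "a > 0"
  shows "\<exists>s\<ge>0. 2 powr (- a * s) < (e::real)"
proof -
  define s where "s = max 0 (1 - log 2 e) / a"
  have "2 powr (- a * s) \<le> 2 powr (log 2 e - 1)" using assms by (simp add: s_def)
  also have "\<dots> < 2 powr (log 2 e)" by simp
  also have "\<dots> = e" using assms by simp
  finally show ?thesis using assms by (intro exI[of _ s]) (auto simp: s_def)
qed

text \<open>The constants of a cover are fixed here so that the estimates below can name them. The inequality
  \<open>shrink\<close> says that a small ellipsoid meeting a large one is small also in the norm that the
  large one defines.\<close>

locale ellipsoid_cover_bounds =
  fixes M :: "real^'n \<Rightarrow> real \<Rightarrow> real^'n^'n" and a1 a2 a5 a6 :: real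
  assumes pos: "a1 > 0" "a2 > 0" "a5 > 0" "a6 > 0"
    and invertible: "\<And>x t. invertible (M x t)"
    and volume_ge: "\<And>x t. a1 * 2 powr (- t) \<le> measure lebesgue (ellipsoid M x t)"
    and volume_le: "\<And>x t. measure lebesgue (ellipsoid M x t) \<le> a2 * 2 powr (- t)"
    and shrink: "\<And>x y t s. s \<ge> 0 \<Longrightarrow> ellipsoid M x t \<inter> ellipsoid M y (t + s) \<noteq> {} \<Longrightarrow>
      opnorm (matrix_inv (M x t) ** M y (t + s)) \<le> a5 * 2 powr (- a6 * s)"
begin

lemma norm_inv_le:
  assumes "s \<ge> 0" "ellipsoid M x t \<inter> ellipsoid M y (t + s) \<noteq> {}"
  shows "norm (matrix_inv (M x t) *v h)
    \<le> a5 * 2 powr (- a6 * s) * norm (matrix_inv (M y (t + s)) *v h)"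
proof -
  let ?A = "M x t" and ?B = "M y (t + s)"
  have "matrix_inv ?A *v h = (matrix_inv ?A ** ?B) *v (matrix_inv ?B *v h)"
    by (simp add: matrix_vector_mul_assoc matrix_mul_assoc[symmetric]
        matrix_mul_matrix_inv[OF invertible])
  then have "norm (matrix_inv ?A *v h)
      \<le> opnorm (matrix_inv ?A ** ?B) * norm (matrix_inv ?B *v h)"
    unfolding opnorm_def by (simp only: onorm[OF matrix_vector_mul_bounded_linear])
  then show ?thesis
    using mult_right_mono[OF shrink[OF assms] norm_ge_zero] by (rule order_trans)
qed

lemma center_mem: "x \<in> ellipsoid M x t"
  by (simp add: mem_ellipsoid_iff invertible)

text \<open>The ellipsoid
  centred at \<open>x\<close> with parameter \<open>- log\<^sub>2 R\<close> has volume comparable to \<open>R\<close>; an ellipsoid of volume at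
  most \<open>a\<^sub>1 R\<close> through \<open>x\<close> has a parameter \<open>t\<close> with \<open>t \<ge> - log\<^sub>2 R\<close>, so \<open>shrink\<close> bounds its diameter in
  the norm given by the larger ellipsoid.\<close>

lemma norm_inv_diff_le_if_small_volume:
  assumes R: "R > 0" and V: "measure lebesgue (ellipsoid M z t) \<le> V" "V \<le> a1 * R"
    and x: "x \<in> ellipsoid M z t" and w: "w \<in> ellipsoid M z t" "w' \<in> ellipsoid M z t"
  shows "norm (matrix_inv (M x (- log 2 R)) *v (w - w')) \<le> 2 * a5 * (V / (a1 * R)) powr a6"
proof -
  let ?A = "M x (- log 2 R)" and ?B = "M z t"
  define s where "s = t + log 2 R"
  have R_eq: "2 powr log 2 R = R" using R by simp
  have "a1 * 2 powr (- t) \<le> V" using volume_ge[of t z] V by linarith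
  then have "2 powr (- t) / R \<le> V / (a1 * R)" using pos R by (simp add: field_simps)
  moreover have "2 powr (- s) = 2 powr (- t) / R"
    using R_eq by (simp add: s_def powr_diff)
  ultimately have small: "2 powr (- s) \<le> V / (a1 * R)" by simp
  moreover have "V / (a1 * R) \<le> 1" using V pos R by (simp add: field_simps)
  ultimately have "2 powr (- s) \<le> 2 powr 0" by simp
  then have s: "s \<ge> 0" by (subst (asm) powr_le_cancel_iff) auto
  have t: "t = - log 2 R + s" by (simp add: s_def)
  have "matrix_inv ?B *v (w - w') = matrix_inv ?B *v (w - z) - matrix_inv ?B *v (w' - z)"
    by (simp add: matrix_vector_mult_diff_distrib)
  also have "norm \<dots> \<le> norm (matrix_inv ?B *v (w - z)) + norm (matrix_inv ?B *v (w' - z))"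
    by (rule norm_triangle_ineq4)
  also have "\<dots> \<le> 2" using w by (simp add: mem_ellipsoid_iff invertible)
  finally have B: "norm (matrix_inv ?B *v (w - w')) \<le> 2" .
  have "norm (matrix_inv ?A *v (w - w'))
      \<le> a5 * 2 powr (- a6 * s) * norm (matrix_inv ?B *v (w - w'))"
    using norm_inv_le[of s x "- log 2 R" z] s center_mem[of x] x unfolding t[symmetric] by blast
  also have "\<dots> \<le> a5 * 2 powr (- a6 * s) * 2"
    using B pos by (intro mult_left_mono) auto
  also have "2 powr (- a6 * s) = (2 powr (- s)) powr a6" by (simp add: powr_powr mult.commute)
  also have "a5 * \<dots> * 2 \<le> 2 * a5 * (V / (a1 * R)) powr a6"
    using powr_mono2[OF _ _ small, of a6] pos by simp
  finally show ?thesis .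
qed

text \<open>The ellipsoids centred at \<open>x\<close> exhaust the space as their parameter tends to \<open>-\<infinity>\<close>. Without
  this the infimum in the definition of \<open>rho\<close> could range over the empty set.\<close>

lemma ex_common_ellipsoid: "\<exists>t. x \<in> ellipsoid M x t \<and> y \<in> ellipsoid M x t"
proof -
  define d where "d = a5 * norm (matrix_inv (M x 0) *v (y - x))"
  have "d \<ge> 0" using pos by (simp add: d_def)
  obtain s where s: "s \<ge> 0" "2 powr (- a6 * s) < 1 / (d + 1)"
    using ex_two_powr_less[of "1 / (d + 1)" a6] pos \<open>d \<ge> 0\<close> by auto
  have "ellipsoid M x (- s) \<inter> ellipsoid M x (- s + s) \<noteq> {}"
    using center_mem by blast
  from norm_inv_le[OF s(1) this, of "y - x"]
  have "norm (matrix_inv (M x (- s)) *v (y - x)) \<le> d * 2 powr (- a6 * s)"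
    by (simp add: d_def mult_ac)
  also have "\<dots> \<le> d * (1 / (d + 1))" using s \<open>d \<ge> 0\<close> by (intro mult_left_mono) auto
  also have "\<dots> < 1" using \<open>d \<ge> 0\<close> by simp
  finally show ?thesis
    using center_mem by (intro exI[of _ "- s"]) (simp add: mem_ellipsoid_iff invertible)
qed

lemma rho_less_iff:
  "rho M x y < r \<longleftrightarrow>
    (\<exists>z t. x \<in> ellipsoid M z t \<and> y \<in> ellipsoid M z t \<and> measure lebesgue (ellipsoid M z t) < r)"
  unfolding rho_def using ex_common_ellipsoid[of x y]
  by (subst cInf_less_iff) (auto intro!: bdd_belowI[of _ 0])

lemma rho_nonneg: "rho M x y \<ge> 0"
  using rho_less_iff[of x y 0] by (metis linorder_not_le measure_nonneg)

lemma rho_same: "rho M x x = 0"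
proof -
  have "rho M x x \<le> e" if "e > 0" for e
  proof -
    obtain t where t: "2 powr (- 1 * t) < e / a2"
      using ex_two_powr_less[of "e / a2" 1] divide_pos_pos[OF \<open>e > 0\<close> pos(2)] by auto
    have "rho M x x \<le> a2 * 2 powr (- t)"
      using rho_le_measure[of x M x t x] center_mem volume_le[of x t] by (auto intro: order_trans)
    also have "\<dots> \<le> e" using t pos by (simp add: field_simps)
    finally show ?thesis .
  qed
  then show ?thesis using rho_nonneg field_le_epsilon[of "rho M x x" 0] by (simp add: antisym)
qed

text \<open>If \<open>\<rho>(x,y) = 0\<close>, then ellipsoids of arbitrarily small volume contain both points. Measured in the
  norm of the fixed ellipsoid at \<open>x\<close> with parameter \<open>0\<close>, their diameters tend to \<open>0\<close>.\<close>

lemma rho_pos: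
  assumes "x \<noteq> y"
  shows "rho M x y > 0"
proof (rule ccontr)
  assume not_pos: "\<not> ?thesis"
  define d where "d = norm (matrix_inv (M x 0) *v (x - y))"
  have "M x 0 *v (matrix_inv (M x 0) *v (x - y)) = x - y"
    by (simp add: matrix_vector_mul_assoc matrix_mul_matrix_inv invertible)
  then have "d > 0" using assms unfolding d_def
    by (metis eq_iff_diff_eq_0 matrix_vector_mult_0_right zero_less_norm_iff)
  \<comment> \<open>The volume at which the diameter bound equals \<open>d / 2\<close>, capped so that it is at most \<open>a1\<close>.\<close>
  define V where "V = a1 * min 1 ((d / (4 * a5)) powr (1 / a6))"
  have "V > 0" using pos \<open>d > 0\<close> by (simp add: V_def)
  then have "rho M x y < V" using not_pos by linarith
  then obtain z t where "x \<in> ellipsoid M z t" "y \<in> ellipsoid M z t"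
    "measure lebesgue (ellipsoid M z t) < V"
    by (auto simp: rho_less_iff)
  from norm_inv_diff_le_if_small_volume[of 1 z t V x x y] this
  have "d \<le> 2 * a5 * (V / a1) powr a6" using pos by (simp add: d_def V_def)
  also have "(V / a1) powr a6 \<le> ((d / (4 * a5)) powr (1 / a6)) powr a6"
    using pos by (intro powr_mono2) (auto simp: V_def)
  also have "\<dots> = d / (4 * a5)" using pos \<open>d > 0\<close> by (simp add: powr_powr)
  also have "2 * a5 * (d / (4 * a5)) = d / 2" using pos by simp
  finally show False using \<open>d > 0\<close> pos by simp
qed

text \<open>A \<open>\<rho>\<close>-ball is the union of the small ellipsoids through its centre.\<close>

lemma open_rho_ball: "open (rho_ball M y r)"
proof -
  have "rho_ball M y r =
      \<Union>{ellipsoid M z t |z t. y \<in> ellipsoid M z t \<and> measure lebesgue (ellipsoid M z t) < r}"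
    by (auto simp: rho_ball_def rho_less_iff)
  moreover have "\<And>z t. open (ellipsoid M z t)" by (rule open_ellipsoid[OF invertible])
  ultimately show ?thesis by (auto intro: open_Union)
qed

text \<open>All ellipsoids of volume less than \<open>R\<close> through \<open>y\<close> lie in a fixed dilate of one ellipsoid centred
  at \<open>y\<close> whose volume is comparable to \<open>R\<close>. The dilation factor exceeds the diameter bound
  \<open>2 a\<^sub>5\<close>.\<close>

lemma emeasure_rho_ball_le:
  assumes "R > 0"
  shows "emeasure lebesgue (rho_ball M y R) \<le> ennreal ((2 * a5 + 1) ^ CARD('n) * a2 / a1 * R)"
proof -
  define t where "t = - log 2 (R / a1)"
  define b where "b = 2 * a5 + 1"
  have b: "b > 0" "2 * a5 < b" using pos by (auto simp: b_def)
  let ?A = "M y t" and ?\<theta> = "ellipsoid M y t"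
  have "rho_ball M y R \<subseteq> (\<lambda>x. b *\<^sub>R x + (y - b *\<^sub>R y)) ` ?\<theta>"
  proof
    fix w assume "w \<in> rho_ball M y R"
    then obtain z u where zu: "y \<in> ellipsoid M z u" "w \<in> ellipsoid M z u"
      "measure lebesgue (ellipsoid M z u) < R"
      by (auto simp: rho_ball_def rho_less_iff)
    define v where "v = y + (1 / b) *\<^sub>R (w - y)"
    have "norm (matrix_inv ?A *v (w - y)) \<le> 2 * a5"
      using norm_inv_diff_le_if_small_volume[of "R / a1" z u R y w y] zu pos assms
      by (simp add: t_def)
    then have "norm (matrix_inv ?A *v (v - y)) < 1"
      using b by (simp add: v_def matrix_vector_mult_scaleR)
    then have "v \<in> ?\<theta>" by (simp add: mem_ellipsoid_iff invertible)
    moreover have "w = b *\<^sub>R v + (y - b *\<^sub>R y)"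
      using b by (simp add: v_def algebra_simps)
    ultimately show "w \<in> (\<lambda>x. b *\<^sub>R x + (y - b *\<^sub>R y)) ` ?\<theta>" by blast
  qed
  then have "emeasure lebesgue (rho_ball M y R)
      \<le> emeasure lebesgue ((\<lambda>x. b *\<^sub>R x + (y - b *\<^sub>R y)) ` ?\<theta>)"
    using open_affinity[OF open_ellipsoid[of M y t, OF invertible], of b "y - b *\<^sub>R y"] b
    by (intro emeasure_mono) (auto simp: add.commute image_image)
  also have "\<dots> = ennreal (b ^ CARD('n)) * ennreal (measure lebesgue ?\<theta>)"
  proof -
    have "?\<theta> \<in> lmeasurable"
      using bounded_ellipsoid open_ellipsoid[of M y t, OF invertible] by (rule lmeasurable_open)
    then show ?thesis
      using b emeasure_lebesgue_affine[of b "y - b *\<^sub>R y" ?\<theta>]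
      by (simp add: emeasure_eq_measure2 ennreal_power)
  qed
  also have "\<dots> = ennreal (b ^ CARD('n) * measure lebesgue ?\<theta>)"
    using b by (simp add: ennreal_mult'')
  also have "\<dots> \<le> ennreal (b ^ CARD('n) * (a2 * (R / a1)))"
  proof -
    have "2 powr (- t) = R / a1" using assms pos by (simp add: t_def)
    then have "measure lebesgue ?\<theta> \<le> a2 * (R / a1)" using volume_le[of y t] by simp
    then show ?thesis using b by (intro ennreal_leI mult_left_mono) auto
  qed
  finally show ?thesis by (simp add: b_def mult_ac)
qed

section \<open>From pointwise estimates to the integral estimate\<close>

text \<open>With \<open>c = 2\<kappa>\<close> the condition on \<open>y'\<close> in the pointwise estimate holds for every \<open>x\<close> in the
  domain of integration. The integrand is dominated by a step function on the balls that bound the dyadic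
  annuli. The function \<open>L(\<cdot>,y)\<close> may fail to be measurable for some \<open>y\<close>, but the nonnegative integral is
  monotone for arbitrary functions and the dominating step function is measurable.\<close>

lemma integral_estimate_if_pointwise_estimates:
  assumes \<kappa>: "\<kappa> \<ge> 1" and \<delta>: "\<delta> > 0" and C: "C > 0"
    and L: "pointwise_estimates M \<kappa> L \<delta> C"
  shows "\<exists>C'>0. integral_estimate M L (2 * \<kappa>) C'"
proof -
  define D where "D = (2 * a5 + 1) ^ CARD('n) * a2 / a1"
  have D: "D > 0" using pos by (simp add: D_def)
  define q where "q = 2 powr (- \<delta>)"
  have q: "0 < q" "q < 1" using \<delta> by (auto simp: q_def powr_less_one)
  have "(\<integral>\<^sup>+x\<in>UNIV - rho_ball M y (2 * \<kappa> * r). ennreal (norm (L x y - L x y')) \<partial>lebesgue)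
      \<le> ennreal (2 * C * D / (1 - q))"
    if r: "r > 0" and y': "y' \<in> rho_ball M y r" for y r y'
  proof -
    define S where "S = 2 * \<kappa> * r"
    have S: "S > 0" "r \<le> S" using \<kappa> r by (auto simp: S_def)
    define B where "B k = rho_ball M y (2 ^ Suc k * S)" for k :: nat
    define g where "g k = C * q ^ k / (2 ^ k * S)" for k :: nat
    have g: "g k \<ge> 0" for k using C q S by (simp add: g_def)
    have B_meas: "B k \<in> sets lebesgue" for k
      unfolding B_def by (simp add: open_rho_ball borel_open)
    have "ennreal (norm (L x y - L x y')) * indicator (UNIV - rho_ball M y S) x
        \<le> (\<Sum>k. ennreal (g k) * indicator (B k) x)" for x
    proof (cases "x \<in> rho_ball M y S")
      case False
      then have far: "rho M x y \<ge> S" by (simp add: rho_ball_def rho_sym)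
      then have "x \<noteq> y" using S rho_same[of y] by auto
      have near: "rho M y y' < r" using y' by (simp add: rho_ball_def)
      have "1 / (2 * \<kappa>) * rho M x y \<ge> r"
        using far \<kappa> by (simp add: S_def field_simps)
      then have est: "norm (L x y - L x y') \<le> C * (rho M y y' powr \<delta> / rho M x y powr (1 + \<delta>))"
        using L \<open>x \<noteq> y\<close> near unfolding pointwise_estimates_def by simp
      \<comment> \<open>The index of the annulus that contains \<open>x\<close>.\<close>
      define k where "k = nat \<lfloor>log 2 (rho M x y / S)\<rfloor>"
      have "log 2 (rho M x y / S) \<ge> 0" using far S by simp
      then have k: "real k \<le> log 2 (rho M x y / S)" "log 2 (rho M x y / S) < real (Suc k)"
        unfolding k_def by linarith+
      have ratio: "rho M x y / S > 0" using far S by simp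
      have lo: "2 ^ k * S \<le> rho M x y"
        using k(1) ratio S by (simp add: le_log_iff powr_realpow pos_le_divide_eq)
      have hi: "rho M x y < 2 ^ Suc k * S"
        using k(2) ratio S by (simp add: log_less_iff powr_realpow pos_divide_less_eq powr_add)
      have "rho M y y' powr \<delta> / rho M x y powr (1 + \<delta>) \<le> S powr \<delta> / (2 ^ k * S) powr (1 + \<delta>)"
        using near S lo \<delta> rho_nonneg[of y y'] by (intro frac_le powr_mono2) auto
      also have "\<dots> = q ^ k / (2 ^ k * S)"
      proof -
        have "q ^ k * (2 ^ k) powr \<delta> = 2 powr (- \<delta> * k) * 2 powr (\<delta> * k)"
          by (simp add: q_def powr_powr mult.commute del: powr_minus_divide flip: powr_realpow)
        also have "\<dots> = 1" by (simp flip: powr_add)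
        finally have "q ^ k = 1 / (2 ^ k) powr \<delta>" by (simp add: eq_divide_eq)
        then show ?thesis using S by (simp add: powr_add powr_mult field_simps)
      qed
      finally have "norm (L x y - L x y') \<le> g k"
        using est C by (simp add: g_def) (smt (verit) mult_left_mono times_divide_eq_right)
      then have "ennreal (norm (L x y - L x y')) * indicator (UNIV - rho_ball M y S) x
          \<le> ennreal (g k) * indicator (B k) x"
        using False hi by (simp add: B_def rho_ball_def rho_sym ennreal_leI)
      also have "\<dots> = (\<Sum>j\<in>{k}. ennreal (g j) * indicator (B j) x)"
        by (simp del: sum_mult_indicator)
      also have "\<dots> \<le> (\<Sum>k. ennreal (g k) * indicator (B k) x)"
        by (rule sum_le_suminf) auto
      finally show ?thesis .
    qed simp
    then have "(\<integral>\<^sup>+x\<in>UNIV - rho_ball M y S. ennreal (norm (L x y - L x y')) \<partial>lebesgue)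
        \<le> (\<integral>\<^sup>+x. (\<Sum>k. ennreal (g k) * indicator (B k) x) \<partial>lebesgue)"
      by (intro nn_integral_mono) auto
    also have "\<dots> = (\<Sum>k. ennreal (g k) * emeasure lebesgue (B k))"
      using B_meas by (subst nn_integral_suminf) (auto simp: nn_integral_cmult_indicator)
    also have "\<dots> \<le> (\<Sum>k. ennreal (2 * C * D * q ^ k))"
    proof (rule suminf_le)
      fix k
      have "emeasure lebesgue (B k) \<le> ennreal (D * (2 ^ Suc k * S))"
        using emeasure_rho_ball_le[of "2 ^ Suc k * S" y] S by (simp add: B_def D_def)
      then have "ennreal (g k) * emeasure lebesgue (B k) \<le> ennreal (g k) * ennreal (D * (2 ^ Suc k * S))"
        by (rule mult_left_mono) simp
      also have "\<dots> = ennreal (2 * C * D * q ^ k)"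
        using g[of k] S by (simp add: g_def flip: ennreal_mult') (simp add: field_simps)
      finally show "ennreal (g k) * emeasure lebesgue (B k) \<le> ennreal (2 * C * D * q ^ k)" .
    qed auto
    also have "\<dots> = ennreal (2 * C * D / (1 - q))"
      using q C D geometric_sums[of q] sums_mult[of "\<lambda>k. q ^ k" "1 / (1 - q)" "2 * C * D"]
      by (intro suminf_ennreal_eq) auto
    finally show ?thesis by (simp add: S_def)
  qed
  then show ?thesis
    using C D q by (intro exI[of _ "2 * C * D / (1 - q)"]) (auto simp: integral_estimate_def)
qed

section \<open>The kernel estimates\<close>

text \<open>The mean value inequality along the segment from \<open>y'\<close> to \<open>y\<close>. At each of its points \<open>\<xi>\<close> the
  derivative is measured in the coordinates adapted to \<open>\<xi>\<close> and the scale \<open>\<rho>(x,\<xi>)\<close>. The ellipsoid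
  contains \<open>\<xi>\<close> and is small at that scale, so the increment \<open>y - y'\<close> is small in these
  coordinates, uniformly in \<open>\<xi>\<close>.\<close>

lemma norm_diff_le_on_ellipsoid:
  fixes f :: "real^'n \<Rightarrow> complex"
  assumes f: "class_C 1 (UNIV - {x}) f"
    and grad: "\<And>\<xi> i. \<xi> \<noteq> x \<Longrightarrow>
      (let A = M \<xi> (- log 2 (rho M x \<xi>))
       in norm (partial_deriv i (\<lambda>v. f (A *v v)) (matrix_inv A *v \<xi>)) \<le> C / rho M x \<xi>)"
    and y: "y \<in> ellipsoid M z t" "y' \<in> ellipsoid M z t"
    and far: "\<And>\<xi>. \<xi> \<in> ellipsoid M z t \<Longrightarrow> R \<le> rho M x \<xi>"
    and V: "measure lebesgue (ellipsoid M z t) \<le> V" "V \<le> a1 * R" and R: "R > 0" and C: "C > 0"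
  shows "norm (f y - f y') \<le> real CARD('n) * (2 * a5 * (V / (a1 * R)) powr a6) * (C / R)"
proof -
  let ?B = "real CARD('n) * (2 * a5 * (V / (a1 * R)) powr a6) * (C / R)"
  define D where "D \<xi> h = (\<Sum>i\<in>UNIV. h $ i *\<^sub>R partial_deriv i f \<xi>)" for \<xi> h
  define \<gamma> where "\<gamma> s = y' + s *\<^sub>R (y - y')" for s
  have "V \<ge> 0" using V(1) measure_nonneg order_trans by blast
  have \<gamma>: "\<gamma> s \<in> ellipsoid M z t" if "s \<in> {0..1}" for s
  proof -
    have "\<gamma> s = (1 - s) *\<^sub>R y' + s *\<^sub>R y" by (simp add: \<gamma>_def algebra_simps)
    then show ?thesis using that y convex_ellipsoid[of M z t] by (simp add: convex_alt)
  qed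
  have deriv: "(f has_derivative D (\<gamma> s)) (at (\<gamma> s))" 
    and bound: "norm (D (\<gamma> s) (y - y')) \<le> ?B" if s: "s \<in> {0..1}" for s
  proof -
    let ?\<xi> = "\<gamma> s"
    let ?r = "rho M x ?\<xi>"
    let ?A = "M ?\<xi> (- log 2 ?r)"
    have r: "R \<le> ?r" using far[OF \<gamma>[OF s]] .
    then have ne: "?\<xi> \<noteq> x" using R rho_same[of x] by auto
    show deriv: "(f has_derivative D ?\<xi>) (at ?\<xi>)"
      unfolding D_def[abs_def] using ne by (intro has_derivative_if_class_C_1[OF f]) auto
    have "norm (D ?\<xi> (y - y')) \<le> real CARD('n) * norm (matrix_inv ?A *v (y - y')) * (C / ?r)"
      using grad[OF ne] by (intro norm_derivative_le_adapted_partials[OF deriv invertible])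
        (simp add: Let_def)
    also have "\<dots> \<le> real CARD('n) * (2 * a5 * (V / (a1 * R)) powr a6) * (C / R)"
    proof -
      have "V \<le> a1 * ?r" using V(2) r pos by (smt (verit) mult_left_mono)
      then have "norm (matrix_inv ?A *v (y - y')) \<le> 2 * a5 * (V / (a1 * ?r)) powr a6"
        using norm_inv_diff_le_if_small_volume[of ?r z t V ?\<xi> y y'] R r V(1) \<gamma>[OF s] y by simp
      also have "\<dots> \<le> 2 * a5 * (V / (a1 * R)) powr a6"
        using pos R r \<open>V \<ge> 0\<close> by (intro mult_left_mono powr_mono2 frac_le) auto
      finally show ?thesis
        using R r C pos by (intro mult_mono frac_le) auto
    qed
    finally show "norm (D ?\<xi> (y - y')) \<le> ?B" .
  qed
  have "norm ((f \<circ> \<gamma>) 1 - (f \<circ> \<gamma>) 0) \<le> ?B * \<bar>1 - 0\<bar>"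
  proof (rule norm_diff_le_if_norm_vector_derivative_le)
    fix s :: real assume s: "s \<in> {0..1}"
    interpret bounded_linear "D (\<gamma> s)" using deriv[OF s] by (rule has_derivative_bounded_linear)
    have "(\<gamma> has_derivative (\<lambda>u. u *\<^sub>R (y - y'))) (at s)"
      unfolding \<gamma>_def[abs_def] by (auto intro!: derivative_eq_intros)
    from has_derivative_compose[OF this, of f "D (\<gamma> s)"] deriv[OF s]
    have "((f \<circ> \<gamma>) has_derivative (\<lambda>u. u *\<^sub>R D (\<gamma> s) (y - y'))) (at s)"
      by (simp add: o_def scaleR)
    then show "((f \<circ> \<gamma>) has_vector_derivative D (\<gamma> s) (y - y')) (at s within {0..1})"
      unfolding has_vector_derivative_def by (rule has_derivative_at_withinI)
  qed (use bound in auto)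
  then show ?thesis by (simp add: \<gamma>_def)
qed

text \<open>The number \<open>q\<close> below is the ratio of \<open>3/2 \<rho>(y,y')\<close>, which bounds the volume of an ellipsoid containing
  \<open>y\<close> and \<open>y'\<close>, to \<open>a\<^sub>1\<close> times the lower bound of \<open>\<rho>(x,\<cdot>)\<close> on this ellipsoid. If \<open>q \<le> 1\<close>, the mean value
  inequality applies; otherwise the factor \<open>q\<close> to the power \<open>a\<^sub>6\<close> is at least \<open>1\<close> and may be inserted into
  the trivial bound.\<close>

lemma pointwise_estimates_if_adapted_gradient_bound:
  assumes \<kappa>: "quasi_triangle_constant M \<kappa>"
    and K: "\<And>x. class_C 1 (UNIV - {x}) (K x)" and C: "C > 0"
    and size: "\<And>x y. x \<noteq> y \<Longrightarrow> norm (K x y) \<le> C / rho M x y"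
    and grad: "\<And>x y i. x \<noteq> y \<Longrightarrow>
      (let A = M y (- log 2 (rho M x y))
       in norm (partial_deriv i (\<lambda>v. K x (A *v v)) (matrix_inv A *v y)) \<le> C / rho M x y)"
  shows "\<exists>C'>0. pointwise_estimates M \<kappa> K a6 C'"
proof -
  have \<kappa>1: "\<kappa> \<ge> 1" and tri: "\<And>x y z. rho M x y \<le> \<kappa> * (rho M x z + rho M y z)"
    using \<kappa> by (auto simp: quasi_triangle_constant_def)
  define n where "n = real CARD('n)"
  define Q where "Q = (6 * \<kappa> / a1) powr a6"
  define C' where "C' = C + C * (1 + 2 * \<kappa> + 8 * n * a5 * \<kappa>) * Q"
  have Q: "Q > 0" using \<kappa>1 pos by (simp add: Q_def)
  have n: "n > 0" by (simp add: n_def)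
  have "C * (1 + 2 * \<kappa> + 8 * n * a5 * \<kappa>) * Q \<ge> 0" using C Q n \<kappa>1 pos by simp
  then have C': "C' > 0" "C \<le> C'" using C by (auto simp: C'_def)
  have "norm (K x y - K x y') \<le> C' * (rho M y y' powr a6 / rho M x y powr (1 + a6))"
    if ne: "x \<noteq> y" and close: "rho M y y' \<le> 1 / (2 * \<kappa>) * rho M x y" for x y y'
  proof (cases "y = y'")
    case False
    define r0 where "r0 = rho M x y"
    define r1 where "r1 = rho M y y'"
    have r: "r0 > 0" "r1 > 0" using ne False by (auto simp: r0_def r1_def rho_pos)
    define q where "q = 6 * \<kappa> * r1 / (a1 * r0)"
    have q: "q > 0" using r \<kappa>1 pos by (simp add: q_def)
    have close': "2 * \<kappa> * r1 \<le> r0" using close \<kappa>1 by (simp add: r0_def r1_def field_simps)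
    have q_powr: "q powr a6 = Q * (r1 powr a6 / r0 powr a6)"
    proof -
      have "q = (6 * \<kappa> / a1) * (r1 / r0)" by (simp add: q_def)
      then show ?thesis using r \<kappa>1 pos by (simp add: Q_def powr_mult powr_divide)
    qed
    have "norm (K x y - K x y') \<le> C * (1 + 2 * \<kappa> + 8 * n * a5 * \<kappa>) / r0 * q powr a6"
    proof (cases "q \<le> 1")
      case True
      \<comment> \<open>The infimum need not be attained. Any factor between \<open>1\<close> and \<open>2\<close> serves: the
         ellipsoid must stay away from \<open>x\<close> even when \<open>2 * \<kappa> * r1 = r0\<close>.\<close>
      have "rho M y y' < 3 / 2 * r1" using r by (simp add: r1_def)
      then obtain z t where zt: "y \<in> ellipsoid M z t" "y' \<in> ellipsoid M z t"
        "measure lebesgue (ellipsoid M z t) < 3 / 2 * r1"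
        unfolding rho_less_iff by blast
      have far: "r0 / (4 * \<kappa>) \<le> rho M x \<xi>" if "\<xi> \<in> ellipsoid M z t" for \<xi>
      proof -
        have "rho M y \<xi> < 3 / 2 * r1" using rho_le_measure[OF zt(1) that] zt(3) by linarith
        then have "\<kappa> * rho M y \<xi> \<le> \<kappa> * (3 / 2 * r1)" using \<kappa>1 by (intro mult_left_mono) auto
        then have "r0 \<le> \<kappa> * rho M x \<xi> + \<kappa> * (3 / 2 * r1)"
          using tri[of x y \<xi>] by (simp add: r0_def distrib_left)
        then have "r0 \<le> 4 * \<kappa> * rho M x \<xi>" using close' by simp
        then show ?thesis using \<kappa>1 by (simp add: field_simps)
      qed
      have q_eq: "3 / 2 * r1 / (a1 * (r0 / (4 * \<kappa>))) = q" by (simp add: q_def)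
      have "3 / 2 * r1 \<le> a1 * (r0 / (4 * \<kappa>))"
        using True r \<kappa>1 pos by (simp add: q_def field_simps)
      then have "norm (K x y - K x y')
          \<le> n * (2 * a5 * q powr a6) * (C / (r0 / (4 * \<kappa>)))"
        using norm_diff_le_on_ellipsoid
            [OF K[of x], of C y z t y' "r0 / (4 * \<kappa>)" "3 / 2 * r1"]
          zt far r \<kappa>1 C grad[of x] unfolding q_eq n_def by (simp add: less_imp_le)
      also have "\<dots> = C * (8 * n * a5 * \<kappa>) / r0 * q powr a6" by simp
      also have "\<dots> \<le> C * (1 + 2 * \<kappa> + 8 * n * a5 * \<kappa>) / r0 * q powr a6"
        using C \<kappa>1 r by (intro mult_right_mono divide_right_mono mult_left_mono) auto
      finally show ?thesis .
    next
      case False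
      have "r0 \<le> \<kappa> * rho M x y' + \<kappa> * r1"
        using tri[of x y y'] by (simp add: r0_def r1_def distrib_left)
      then have far: "r0 / (2 * \<kappa>) \<le> rho M x y'" using close' \<kappa>1 by (simp add: field_simps)
      then have "x \<noteq> y'" using r \<kappa>1 rho_same[of x] by (auto simp: field_simps)
      have "norm (K x y - K x y') \<le> norm (K x y) + norm (K x y')" by (rule norm_triangle_ineq4)
      also have "\<dots> \<le> C / r0 + C / (r0 / (2 * \<kappa>))"
      proof (rule add_mono)
        show "norm (K x y) \<le> C / r0" using size[OF ne] by (simp add: r0_def)
        have "norm (K x y') \<le> C / rho M x y'" using size[OF \<open>x \<noteq> y'\<close>] .
        also have "\<dots> \<le> C / (r0 / (2 * \<kappa>))" using far r \<kappa>1 C by (intro frac_le) auto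
        finally show "norm (K x y') \<le> C / (r0 / (2 * \<kappa>))" .
      qed
      also have "\<dots> = C * (1 + 2 * \<kappa>) / r0 * 1"
        by (simp add: algebra_simps add_divide_distrib)
      also have "\<dots> \<le> C * (1 + 2 * \<kappa> + 8 * n * a5 * \<kappa>) / r0 * q powr a6"
      proof (rule mult_mono)
        show "1 \<le> q powr a6" using False pos by (simp add: ge_one_powr_ge_zero)
        show "C * (1 + 2 * \<kappa>) / r0 \<le> C * (1 + 2 * \<kappa> + 8 * n * a5 * \<kappa>) / r0"
          using C \<kappa>1 r n pos by (intro divide_right_mono mult_left_mono) auto
      qed (use C \<kappa>1 r n pos in auto)
      finally show ?thesis .
    qed
    also have "\<dots> = C * (1 + 2 * \<kappa> + 8 * n * a5 * \<kappa>) * Q * (r1 powr a6 / r0 powr (1 + a6))"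
      using r by (simp add: q_powr powr_add)
    also have "\<dots> \<le> C' * (r1 powr a6 / r0 powr (1 + a6))"
      using C by (intro mult_right_mono) (auto simp: C'_def)
    finally show ?thesis by (simp add: r0_def r1_def)
  qed (use C' in simp)
  moreover have "norm (K x y) \<le> C' / rho M x y" if "x \<noteq> y" for x y
    using size[OF that] divide_right_mono[OF C'(2) rho_nonneg] by (rule order_trans)
  ultimately show ?thesis using C' unfolding pointwise_estimates_def by blast
qed

end

theorem proposition5p7:
  fixes M :: "real^'n \<Rightarrow> real \<Rightarrow> real^'n^'n"
    and T :: "(real^'n \<Rightarrow> complex) \<Rightarrow> real^'n \<Rightarrow> complex"
    and K :: "real^'n \<Rightarrow> real^'n \<Rightarrow> complex"
    and \<kappa> :: real
  assumes "ellipsoid_cover M"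
    and "quasi_triangle_constant M \<kappa>"
    and "vasio_of_order 1 M T K"
  shows "(\<exists>\<delta>>0. \<exists>C>0. pointwise_estimates M \<kappa> K \<delta> C) \<and>
         (\<exists>c>1. \<exists>C>0. integral_estimate M K c C) \<and>
         (\<forall>L \<delta> C. locally_square_integrable L \<and> \<delta> > 0 \<and> C > 0 \<and> pointwise_estimates M \<kappa> L \<delta> C
            \<longrightarrow> (\<exists>c>1. \<exists>C'>0. integral_estimate M L c C'))"
proof -
  obtain a1 a2 a5 a6 where "ellipsoid_cover_bounds M a1 a2 a5 a6"
    using assms(1) unfolding ellipsoid_cover_def ellipsoid_cover_bounds_def by meson
  then interpret ellipsoid_cover_bounds M a1 a2 a5 a6 .
  have \<kappa>: "\<kappa> \<ge> 1" using assms(2) by (simp add: quasi_triangle_constant_def)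
  have integral: "\<exists>c>1. \<exists>C'>0. integral_estimate M L c C'"
    if "\<delta> > 0" "C > 0" "pointwise_estimates M \<kappa> L \<delta> C" for L \<delta> C
    using integral_estimate_if_pointwise_estimates[OF \<kappa> that] \<kappa>
    by (intro exI[of _ "2 * \<kappa>"]) auto
  obtain C where C: "C > 0" and bound: "\<And>x y \<alpha>. x \<noteq> y \<Longrightarrow> length \<alpha> \<le> 1 \<Longrightarrow>
      (let A = M y (- log 2 (rho M x y))
       in norm (iter_partial \<alpha> (\<lambda>v. K x (A *v v)) (matrix_inv A *v y)) \<le> C / rho M x y)"
    using assms(3) unfolding vasio_of_order_def by blast
  have "\<exists>C'>0. pointwise_estimates M \<kappa> K a6 C'"
  proof (rule pointwise_estimates_if_adapted_gradient_bound[OF assms(2) _ C])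
    show "class_C 1 (UNIV - {x}) (K x)" for x using assms(3) by (simp add: vasio_of_order_def)
    fix x y :: "real^'n" and i :: 'n assume ne: "x \<noteq> y"
    show "norm (K x y) \<le> C / rho M x y"
      using bound[OF ne, of "[]"]
      by (simp add: Let_def matrix_vector_mul_assoc matrix_mul_matrix_inv invertible)
    show "let A = M y (- log 2 (rho M x y))
        in norm (partial_deriv i (\<lambda>v. K x (A *v v)) (matrix_inv A *v y)) \<le> C / rho M x y"
      using bound[OF ne, of "[i]"] by simp
  qed
  then show ?thesis using integral pos by blast
qed

end
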